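(* Let $(\Omega,\mathcal F,\mathbb P)$ be a probability space, let $\mathfrak d,\delta,J\in\mathbb N$, let $U_{n,j}\colon\Omega\to\mathbb R^\delta$, $n\in\mathbb N_0$, $j\in\{1,\dots,J\}$, be i.i.d. random variables, let $G\colon\mathbb R^{\mathfrak d}\times\mathbb R^\delta\to\mathbb R^{\mathfrak d}$ be measurable, assume for all $\theta\in\mathbb R^{\mathfrak d}$ that $\mathbb E[\|G(\theta,U_{0,1})\|]<\infty$, let $\alpha\in[0,1)$, $\nu\in\mathbb R^{\mathfrak d}$, let $(\gamma_n)_{n\in\mathbb N_0}\subseteq(0,\infty)$, and let $\Theta,\mathbf m\colon\mathbb N_0\times\Omega\to\mathbb R^{\mathfrak d}$ be stochastic processes which satisfy for all $n\in\mathbb N$ that $$\mathbf m_0=\nu,\qquad \Theta_n=\Theta_{n-1}+\gamma_n\mathbf m_n,\qquad \mathbf m_n=\alpha\mathbf m_{n-1}+(1-\alpha)\Bigl[\frac1J\sum_{j=1}^JG(\Theta_{n-1},U_{n,j})\Bigr].$$ Assume that $\Theta_0$ and $(U_{n,j})_{n\in\mathbb N_0,\,j\in\{1,\dots,J\}}$ are independent, assume $\mathbb E[\|\Theta_0\|^2]<\infty$, for every $n\in\mathbb N_0$ let $\mathcal F_n=\sigma(\{\Theta_k\colon k\in\{0,1,\dots,n\}\})$, assume for all $n\in\mathbb N$, $j\in\{1,\dots,J\}$ that $U_{n,j}$ is independent of $\mathcal F_{n-1}$, and assume $\sup_{n\in\mathbb N_0}(\mathbb E[\|G(\Theta_n,U_{0,1})\|^2])^{1/2}<\infty$.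 Let $c\in(0,\infty)$, $\vartheta\in\mathbb R^{\mathfrak d}$ satisfy for all $\theta\in\mathbb R^{\mathfrak d}$ that $$\langle\theta-\vartheta,\mathbb E[G(\theta,U_{1,1})]\rangle\le-c\max\{\|\theta-\vartheta\|^2,\|\mathbb E[G(\theta,U_{1,1})]\|^2\},$$ and assume for all $j\in\mathbb N$ that $\gamma_{j+1}\le\gamma_j$, that $\limsup_{n\to\infty}\gamma_n=0$, and that $\sum_{n=1}^\infty\gamma_n=\infty$. Then $$\limsup_{n\to\infty}\mathbb E[\|\Theta_n-\vartheta\|^2]=0.$$
   Context: $\mathbb N=\{1,2,3,\dots\}$, $\mathbb N_0=\{0,1,2,\dots\}$; $\langle\cdot,\cdot\rangle$ and $\|\cdot\|$ are the standard Euclidean inner product and norm. For a process $X\colon\mathbb N_0\times\Omega\to\mathbb R^{\mathfrak d}$, $X_n$ denotes $X(n,\cdot)$. *)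

theory Defs
  imports "HOL-Probability.Probability"
begin

(* The smallest sigma-algebra on the sample space making all X i, i : I, measurable. *)
definition generated_algebra ::
    "'a measure \<Rightarrow> ('i \<Rightarrow> 'a \<Rightarrow> 'b::topological_space) \<Rightarrow> 'i set \<Rightarrow> 'a measure" where
  "generated_algebra M X I =
     sigma (space M) (\<Union>i\<in>I. {X i -` A \<inter> space M | A. A \<in> sets borel})"

definition natural_filtration ::
    "'a measure \<Rightarrow> (nat \<Rightarrow> 'a \<Rightarrow> 'b::topological_space) \<Rightarrow> nat \<Rightarrow> 'a measure" where
  "natural_filtration M X n = generated_algebra M X {0..n}"

(* vimage_algebra (space M) X borel is the sigma-algebra generated by the single variable X. *)
definition indep_of_algebra ::
    "'a measure \<Rightarrow> ('a \<Rightarrow> 'b::topological_space) \<Rightarrow> 'a measure \<Rightarrow> bool" where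
  "indep_of_algebra M X F \<longleftrightarrow>
     prob_space.indep_set M (sets (vimage_algebra (space M) X borel)) (sets F)"

definition iid :: "'a measure \<Rightarrow> ('i \<Rightarrow> 'a \<Rightarrow> 'b::topological_space) \<Rightarrow> 'i set \<Rightarrow> bool" where
  "iid M X I \<longleftrightarrow>
     prob_space.indep_vars M (\<lambda>_. borel) X I \<and>
     (\<forall>i\<in>I. \<forall>k\<in>I. distr M borel (X i) = distr M borel (X k))"

end

theory Submission
  imports Defs
begin

text \<open>
  Put \<open>w\<^sub>n = (\<Sum>k. \<alpha>^k \<gamma>\<^bsub>n+1+k\<^esub>)\<close>. The shifted iterate
  \<open>Z\<^sub>n = \<Theta>\<^sub>n + \<alpha> w\<^sub>n m\<^sub>n\<close> then satisfies exactly a recursion without momentum,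
  \<open>Z\<^bsub>n+1\<^esub> = Z\<^sub>n + (1 - \<alpha>) w\<^sub>n H\<^sub>n\<close>, where \<open>H\<^sub>n\<close> is the averaged
  gradient at \<open>\<Theta>\<^sub>n\<close>. Since the momenta are bounded in \<open>L\<^sup>2\<close> and \<open>w\<^sub>n \<longlonglongrightarrow> 0\<close>, the
  shift is negligible in \<open>L\<^sup>2\<close>, and expanding the square gives a recursion
  \<open>a\<^bsub>n+1\<^esub> \<le> (1 - c \<eta>\<^sub>n) a\<^sub>n + \<eta>\<^sub>n \<epsilon>\<^sub>n\<close> for the second moment \<open>a\<^sub>n\<close> of
  \<open>Z\<^sub>n - \<theta>'\<close>, with \<open>\<epsilon>\<^sub>n \<longlonglongrightarrow> 0\<close> and divergent \<open>\<Sum>\<eta>\<^sub>n\<close>.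
  The moment bound, assumed for \<open>U\<^bsub>0,1\<^esub>\<close>, transfers to the gradients actually used because
  \<open>U\<^bsub>0,1\<^esub>\<close> is independent of \<open>\<Theta>\<^sub>n\<close>, which depends only on \<open>\<Theta>\<^sub>0\<close> and
  the \<open>U\<^bsub>k,j\<^esub>\<close> with \<open>1 \<le> k \<le> n\<close>.
\<close>

section \<open>A scalar recursion with vanishing, non-summable steps\<close>

text \<open>Eventually \<epsilon> stays below \<open>c * e\<close>, and from then on the excess of
  \<open>a\<close> over the level \<open>e\<close> contracts by
  \<open>1 - c * \<eta> n \<le> exp (- (c * \<eta> n))\<close>. The product of these factors tends
  to 0 because the \<eta> sum to infinity.\<close>

lemma contraction_recursion_tendsto_zero:
  fixes a \<eta> \<epsilon> :: "nat \<Rightarrow> real"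
  assumes a: "\<And>n. a n \<ge> 0" and \<eta>: "\<And>n. \<eta> n \<ge> 0" and c: "c > 0"
    and \<eta>0: "\<eta> \<longlonglongrightarrow> 0" and div: "\<not> summable \<eta>" and \<epsilon>: "\<epsilon> \<longlonglongrightarrow> 0"
    and rec: "\<And>n. a (Suc n) \<le> (1 - c * \<eta> n) * a n + \<eta> n * \<epsilon> n"
  shows "a \<longlonglongrightarrow> 0"
proof (rule LIMSEQ_I)
  fix r :: real assume "r > 0"
  define e where "e = r / 2"
  have e: "e > 0" using \<open>r > 0\<close> by (simp add: e_def)
  have "(\<lambda>n. c * \<eta> n) \<longlonglongrightarrow> 0" using tendsto_mult_right_zero[OF \<eta>0] by simp
  then have "\<forall>\<^sub>F n in sequentially. c * \<eta> n < 1" by (rule order_tendstoD) simp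
  moreover have "\<forall>\<^sub>F n in sequentially. \<epsilon> n < c * e" using \<epsilon> by (rule order_tendstoD) (use c e in simp)
  ultimately have "\<forall>\<^sub>F n in sequentially. c * \<eta> n < 1 \<and> \<epsilon> n < c * e" by eventually_elim simp
  then obtain N where N: "\<And>n. n \<ge> N \<Longrightarrow> c * \<eta> n < 1 \<and> \<epsilon> n < c * e"
    by (auto simp: eventually_sequentially)
  \<comment> \<open>The level \<open>e\<close> is a fixed point of the recursion once
    \<open>\<epsilon> n\<close> is replaced by \<open>c * e\<close>, so subtracting it removes the
    error term. Taking the positive part keeps the excess nonnegative, which allows the factor to be
    enlarged to an exponential.\<close>
  define b where "b n = max (a n - e) 0" for n
  have step: "b (Suc n) \<le> exp (- (c * \<eta> n)) * b n" if "n \<ge> N" for n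
  proof -
    have "a (Suc n) - e \<le> (1 - c * \<eta> n) * a n + \<eta> n * \<epsilon> n - e" using rec[of n] by simp
    also have "\<dots> \<le> (1 - c * \<eta> n) * a n + \<eta> n * (c * e) - e"
      using mult_left_mono[OF less_imp_le[OF conjunct2[OF N[OF that]]] \<eta>[of n]] by simp
    also have "\<dots> = (1 - c * \<eta> n) * (a n - e)" by (simp add: algebra_simps)
    also have "\<dots> \<le> (1 - c * \<eta> n) * b n"
      using N[OF that] by (intro mult_left_mono) (auto simp: b_def)
    also have "\<dots> \<le> exp (- (c * \<eta> n)) * b n"
      using exp_ge_add_one_self[of "- (c * \<eta> n)"] by (intro mult_right_mono) (auto simp: b_def)
    finally show ?thesis by (simp add: b_def)
  qed
  have bound: "b (N + k) \<le> exp (- (c * (\<Sum>i<k. \<eta> (N + i)))) * b N" for k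
  proof (induction k)
    case (Suc k)
    have "b (N + Suc k) \<le> exp (- (c * \<eta> (N + k))) * b (N + k)" using step[of "N + k"] by simp
    also have "\<dots> \<le> exp (- (c * \<eta> (N + k))) * (exp (- (c * (\<Sum>i<k. \<eta> (N + i)))) * b N)"
      using Suc by (intro mult_left_mono) auto
    also have "\<dots> = exp (- (c * (\<Sum>i<Suc k. \<eta> (N + i)))) * b N"
      by (simp add: exp_add[symmetric] algebra_simps)
    finally show ?case .
  qed simp
  have "\<not> summable (\<lambda>i. \<eta> (N + i))"
    using div summable_iff_shift[of \<eta> N] by (simp add: add.commute)
  then have "\<not> bdd_above (range (\<lambda>k. \<Sum>i<k. \<eta> (N + i)))"
    using \<eta> bounded_imp_summable[of "\<lambda>i. \<eta> (N + i)"]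
    by (metis (no_types, lifting) bdd_above.E lessThan_Suc_atMost rangeI)
  then have big: "\<exists>k. B < (\<Sum>i<k. \<eta> (N + i))" for B
    by (auto simp: bdd_above_def not_le) 
  obtain B where B: "exp (- (c * B)) * b N < e"
  proof -
    \<comment> \<open>With this choice the claim becomes \<open>x < exp x\<close> for
      \<open>x = b N / e\<close>.\<close>
    define B where "B = b N / (c * e)"
    have bN: "b N \<ge> 0" by (simp add: b_def)
    have "exp (- (c * B)) * b N = b N / exp (b N / e)" using c by (simp add: B_def exp_minus field_simps)
    also have "\<dots> < e"
    proof -
      have "b N / e < exp (b N / e)" using exp_ge_add_one_self[of "b N / e"] by linarith
      then show ?thesis using e by (simp add: field_simps)
    qed
    finally show thesis by (rule that)
  qed
  obtain K where K: "B < (\<Sum>i<K. \<eta> (N + i))" using big by blast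
  have "norm (a n - 0) < r" if n: "n \<ge> N + K" for n
  proof -
    obtain k where k: "n = N + k" "k \<ge> K" using n by (metis add_leD1 le_add_diff_inverse nat_add_left_cancel_le)
    have "(\<Sum>i<K. \<eta> (N + i)) \<le> (\<Sum>i<k. \<eta> (N + i))" using k \<eta> by (intro sum_mono2) auto
    then have "B \<le> (\<Sum>i<k. \<eta> (N + i))" using K by simp
    then have "exp (- (c * (\<Sum>i<k. \<eta> (N + i)))) * b N \<le> exp (- (c * B)) * b N"
      using c by (intro mult_right_mono) (auto simp: b_def)
    then have "b n < e" using bound[of k] B k by simp
    then have "a n < 2 * e" by (auto simp: b_def)
    then show ?thesis using a[of n] by (simp add: e_def)
  qed
  then show "\<exists>n0. \<forall>n\<ge>n0. norm (a n - 0) < r" by blast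
qed

section \<open>Inequalities for squared norms and square integrability\<close>

text \<open>The gap between the two sides is exactly
  \<open>\<alpha> * (1 - \<alpha>) * (norm (x - y))\<^sup>2\<close>. This convexity keeps the second
  moments of the momenta bounded.\<close>

lemma norm_convex_comb_sq_le:
  fixes x y :: "'b::real_inner"
  assumes "0 \<le> \<alpha>" "\<alpha> \<le> 1"
  shows "(norm (\<alpha> *\<^sub>R x + (1 - \<alpha>) *\<^sub>R y))\<^sup>2 \<le> \<alpha> * (norm x)\<^sup>2 + (1 - \<alpha>) * (norm y)\<^sup>2"
proof -
  have "\<alpha> * (norm x)\<^sup>2 + (1 - \<alpha>) * (norm y)\<^sup>2 - (norm (\<alpha> *\<^sub>R x + (1 - \<alpha>) *\<^sub>R y))\<^sup>2
      = \<alpha> * (1 - \<alpha>) * (norm (x - y))\<^sup>2"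
    unfolding power2_norm_eq_inner by (simp add: inner_simps inner_commute algebra_simps power2_eq_square)
  also have "\<dots> \<ge> 0" using assms by simp
  finally show ?thesis by simp
qed

lemma norm_add_sq_le: "(norm (x + y))\<^sup>2 \<le> 2 * (norm x)\<^sup>2 + 2 * (norm (y::'b::real_inner))\<^sup>2"
proof -
  have "2 * (norm x)\<^sup>2 + 2 * (norm y)\<^sup>2 - (norm (x + y))\<^sup>2 = (norm (x - y))\<^sup>2"
    unfolding power2_norm_eq_inner by (simp add: inner_simps inner_commute algebra_simps)
  then show ?thesis by (smt (verit) zero_le_power2)
qed

lemma two_inner_le: "2 * (x \<bullet> y) \<le> (norm x)\<^sup>2 + (norm (y::'b::real_inner))\<^sup>2"
proof -
  have "(norm x)\<^sup>2 + (norm y)\<^sup>2 - 2 * (x \<bullet> y) = (norm (x - y))\<^sup>2"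
    unfolding power2_norm_eq_inner by (simp add: inner_simps inner_commute algebra_simps)
  then show ?thesis by (smt (verit) zero_le_power2)
qed

text \<open>Triangle inequality, then Cauchy-Schwarz for the norms. There is no loss of a constant,
  so an average inherits a common second moment bound of its terms.\<close>

lemma norm_mean_sq_le:
  fixes x :: "nat \<Rightarrow> 'b::real_inner"
  assumes "J \<ge> 1"
  shows "(norm ((1 / real J) *\<^sub>R (\<Sum>j = 1..J. x j)))\<^sup>2 \<le> (1 / real J) * (\<Sum>j = 1..J. (norm (x j))\<^sup>2)"
proof -
  have "(norm (\<Sum>j = 1..J. x j))\<^sup>2 \<le> (\<Sum>j = 1..J. norm (x j))\<^sup>2"
    by (intro power_mono norm_sum) auto
  also have "\<dots> \<le> (\<Sum>j = 1..J. (norm (x j))\<^sup>2) * real J"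
    using sum_squared_le_sum_of_squares[of "\<lambda>j. norm (x j)" "{1..J}"] by simp
  finally show ?thesis using assms
    by (simp add: power_mult_distrib power2_eq_square field_simps)
qed

lemma integrable_norm_add_sq:
  fixes X Y :: "'a \<Rightarrow> 'b::euclidean_space"
  assumes [measurable]: "X \<in> borel_measurable M" "Y \<in> borel_measurable M"
    and "integrable M (\<lambda>\<omega>. (norm (X \<omega>))\<^sup>2)" "integrable M (\<lambda>\<omega>. (norm (Y \<omega>))\<^sup>2)"
  shows "integrable M (\<lambda>\<omega>. (norm (X \<omega> + Y \<omega>))\<^sup>2)"
proof (rule Bochner_Integration.integrable_bound)
  show "integrable M (\<lambda>\<omega>. 2 * (norm (X \<omega>))\<^sup>2 + 2 * (norm (Y \<omega>))\<^sup>2)" using assms by simp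
qed (use norm_add_sq_le in \<open>auto\<close>)

lemma integrable_norm_scaleR_sq:
  fixes X :: "'a \<Rightarrow> 'b::euclidean_space"
  assumes "integrable M (\<lambda>\<omega>. (norm (X \<omega>))\<^sup>2)"
  shows "integrable M (\<lambda>\<omega>. (norm (r *\<^sub>R X \<omega>))\<^sup>2)"
  using assms by (simp add: power_mult_distrib)

lemma integrable_inner_sq:
  fixes X Y :: "'a \<Rightarrow> 'b::euclidean_space"
  assumes [measurable]: "X \<in> borel_measurable M" "Y \<in> borel_measurable M"
    and "integrable M (\<lambda>\<omega>. (norm (X \<omega>))\<^sup>2)" "integrable M (\<lambda>\<omega>. (norm (Y \<omega>))\<^sup>2)"
  shows "integrable M (\<lambda>\<omega>. X \<omega> \<bullet> Y \<omega>)"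
proof (rule Bochner_Integration.integrable_bound)
  show "integrable M (\<lambda>\<omega>. (norm (X \<omega>))\<^sup>2 + (norm (Y \<omega>))\<^sup>2)" using assms by simp
  have "\<bar>x \<bullet> y\<bar> \<le> (norm x)\<^sup>2 + (norm y)\<^sup>2" for x y :: 'b
    using two_inner_le[of x y] two_inner_le[of "- x" y] by (auto simp: abs_le_iff)
  then show "AE \<omega> in M. norm (X \<omega> \<bullet> Y \<omega>) \<le> norm ((norm (X \<omega>))\<^sup>2 + (norm (Y \<omega>))\<^sup>2)" by simp
qed simp

text \<open>Splitting off the term \<open>k = 0\<close> gives the backward recursion, the identity
  that makes the momentum cancel later. The two bounds make \<open>w\<close> comparable to
  \<open>s\<close>: the lower one passes on divergence of the sum, the upper one convergence to
  0.\<close>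

lemma geometric_tail_sum:
  fixes s :: "nat \<Rightarrow> real"
  assumes \<alpha>: "0 \<le> \<alpha>" "\<alpha> < 1" and s: "\<And>n. s n \<ge> 0" "decseq s"
  defines "w \<equiv> \<lambda>n. \<Sum>k. \<alpha> ^ k * s (n + k)"
  shows "w n = s n + \<alpha> * w (Suc n)" and "s n \<le> w n" and "w n \<le> s n / (1 - \<alpha>)"
proof -
  have geo: "summable (\<lambda>k. \<alpha> ^ k * s n)" for n using \<alpha> by (intro summable_mult2 summable_geometric) simp
  have le: "\<alpha> ^ k * s (n + k) \<le> \<alpha> ^ k * s n" for n k
    using \<alpha> s by (intro mult_left_mono) (auto simp: decseq_def)
  have sm: "summable (\<lambda>k. \<alpha> ^ k * s (n + k))" for n
    using \<alpha> s le by (intro summable_comparison_test'[OF geo[of n]]) (auto simp: abs_mult)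
  show eq: "w n = s n + \<alpha> * w (Suc n)" for n
    using suminf_split_head[OF sm[of n]] suminf_mult[OF sm[of "Suc n"], of \<alpha>]
    by (simp add: w_def mult.assoc)
  have "w (Suc n) \<ge> 0" using \<alpha> s by (auto simp: w_def intro!: suminf_nonneg sm[of "Suc n", simplified])
  then show "s n \<le> w n" using eq[of n] \<alpha> by simp
  have "w n \<le> (\<Sum>k. \<alpha> ^ k * s n)" unfolding w_def by (intro suminf_le le sm geo)
  also have "\<dots> = s n / (1 - \<alpha>)" using \<alpha> suminf_mult2[of "\<lambda>k. \<alpha> ^ k" "s n"] 
    by (simp add: suminf_geometric summable_geometric)
  finally show "w n \<le> s n / (1 - \<alpha>)" .
qed

section \<open>Momentum recursions in the space of square integrable variables\<close>

text \<open>The gradients enter only as square integrable variables \<open>H n\<close>; independence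
  is dealt with outside. Indices are shifted: \<open>H n\<close> and \<open>s n\<close> belong to
  the step from \<open>n\<close> to \<open>Suc n\<close>.\<close>

locale momentum_process = prob_space M for M :: "'a measure" +
  fixes \<Theta> m H :: "nat \<Rightarrow> 'a \<Rightarrow> 'b::euclidean_space" and \<alpha> :: real and s :: "nat \<Rightarrow> real"
  assumes \<Theta>_measurable [measurable]: "\<And>n. \<Theta> n \<in> borel_measurable M"
    and m_measurable [measurable]: "\<And>n. m n \<in> borel_measurable M"
    and H_measurable [measurable]: "\<And>n. H n \<in> borel_measurable M"
    and \<alpha>: "0 \<le> \<alpha>" "\<alpha> < 1"
    and s_nonneg: "\<And>n. 0 \<le> s n"
    and s_decseq: "decseq s"
    and m_Suc: "\<And>n \<omega>. \<omega> \<in> space M \<Longrightarrow> m (Suc n) \<omega> = \<alpha> *\<^sub>R m n \<omega> + (1 - \<alpha>) *\<^sub>R H n \<omega>"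
    and \<Theta>_Suc: "\<And>n \<omega>. \<omega> \<in> space M \<Longrightarrow> \<Theta> (Suc n) \<omega> = \<Theta> n \<omega> + s n *\<^sub>R m (Suc n) \<omega>"
    and \<Theta>_0_L2: "integrable M (\<lambda>\<omega>. (norm (\<Theta> 0 \<omega>))\<^sup>2)"
    and m_0_L2: "integrable M (\<lambda>\<omega>. (norm (m 0 \<omega>))\<^sup>2)"
    and H_L2: "\<And>n. integrable M (\<lambda>\<omega>. (norm (H n \<omega>))\<^sup>2)"
begin

lemma m_L2: "integrable M (\<lambda>\<omega>. (norm (m n \<omega>))\<^sup>2)"
proof (induction n)
  case (Suc n)
  have "integrable M (\<lambda>\<omega>. (norm (\<alpha> *\<^sub>R m n \<omega> + (1 - \<alpha>) *\<^sub>R H n \<omega>))\<^sup>2)"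
    by (intro integrable_norm_add_sq integrable_norm_scaleR_sq Suc H_L2) measurable
  then show ?case
    by (subst Bochner_Integration.integrable_cong[OF refl]) (simp_all add: m_Suc)
qed (rule m_0_L2)

lemma \<Theta>_L2: "integrable M (\<lambda>\<omega>. (norm (\<Theta> n \<omega>))\<^sup>2)"
proof (induction n)
  case (Suc n)
  have "integrable M (\<lambda>\<omega>. (norm (\<Theta> n \<omega> + s n *\<^sub>R m (Suc n) \<omega>))\<^sup>2)"
    by (intro integrable_norm_add_sq integrable_norm_scaleR_sq Suc m_L2) measurable
  then show ?case
    by (subst Bochner_Integration.integrable_cong[OF refl]) (simp_all add: \<Theta>_Suc)
qed (rule \<Theta>_0_L2)

lemma \<Theta>_diff_L2: "integrable M (\<lambda>\<omega>. (norm (\<Theta> n \<omega> - \<theta>))\<^sup>2)"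
  using integrable_norm_add_sq[OF \<Theta>_measurable _ \<Theta>_L2, of "\<lambda>_. - \<theta>"] by simp

text \<open>Each new momentum is a convex combination of the old one and \<open>H n\<close>, so by
  convexity its second moment never exceeds the larger of the two bounds.\<close>

lemma m_moment_le:
  assumes "\<And>n. expectation (\<lambda>\<omega>. (norm (H n \<omega>))\<^sup>2) \<le> K"
  shows "expectation (\<lambda>\<omega>. (norm (m n \<omega>))\<^sup>2) \<le> max K (expectation (\<lambda>\<omega>. (norm (m 0 \<omega>))\<^sup>2))"
    (is "_ \<le> ?L")
proof (induction n)
  case (Suc n)
  have "expectation (\<lambda>\<omega>. (norm (m (Suc n) \<omega>))\<^sup>2)
      \<le> expectation (\<lambda>\<omega>. \<alpha> * (norm (m n \<omega>))\<^sup>2 + (1 - \<alpha>) * (norm (H n \<omega>))\<^sup>2)"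
    using \<alpha> m_L2 H_L2
    by (intro integral_mono) (auto simp: m_Suc intro!: norm_convex_comb_sq_le)
  also have "\<dots> = \<alpha> * expectation (\<lambda>\<omega>. (norm (m n \<omega>))\<^sup>2)
      + (1 - \<alpha>) * expectation (\<lambda>\<omega>. (norm (H n \<omega>))\<^sup>2)"
    using m_L2 H_L2 by simp
  also have "\<dots> \<le> \<alpha> * ?L + (1 - \<alpha>) * ?L"
    using \<alpha> Suc assms[of n] by (intro add_mono mult_left_mono) auto
  finally show ?case by (simp add: algebra_simps)
qed simp

definition w :: "nat \<Rightarrow> real" where "w n = (\<Sum>k. \<alpha> ^ k * s (n + k))"

lemmas w_props = geometric_tail_sum[OF \<alpha> s_nonneg s_decseq, folded w_def]

text \<open>This is the point to which the iterates would converge if all gradients from time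
  \<open>n\<close> on were zero: the remaining momentum would then move \<open>\<Theta> n\<close> by
  the sum of \<open>s (n + k) * \<alpha> ^ (k + 1)\<close> times \<open>m n\<close>.\<close>

definition Z :: "nat \<Rightarrow> 'a \<Rightarrow> 'b" where "Z n \<omega> = \<Theta> n \<omega> + (\<alpha> * w n) *\<^sub>R m n \<omega>"

text \<open>The coefficient of \<open>m (Suc n)\<close> is
  \<open>s n + \<alpha> * w (Suc n) = w n\<close>. Expanding \<open>m (Suc n)\<close> then
  reproduces the shift contained in \<open>Z n\<close> and leaves one gradient term.\<close>

lemma Z_Suc:
  assumes "\<omega> \<in> space M"
  shows "Z (Suc n) \<omega> = Z n \<omega> + ((1 - \<alpha>) * w n) *\<^sub>R H n \<omega>"
proof -
  have "Z (Suc n) \<omega> = \<Theta> n \<omega> + (s n + \<alpha> * w (Suc n)) *\<^sub>R m (Suc n) \<omega>"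
    using assms by (simp add: Z_def \<Theta>_Suc algebra_simps)
  also have "s n + \<alpha> * w (Suc n) = w n" using w_props(1)[of n] by simp
  finally show ?thesis using assms by (simp add: Z_def m_Suc algebra_simps)
qed

lemma Z_measurable [measurable]: "Z n \<in> borel_measurable M"
  unfolding Z_def by measurable

lemma Z_diff_L2: "integrable M (\<lambda>\<omega>. (norm (Z n \<omega> - \<theta>))\<^sup>2)"
proof -
  have "integrable M (\<lambda>\<omega>. (norm ((\<Theta> n \<omega> - \<theta>) + (\<alpha> * w n) *\<^sub>R m n \<omega>))\<^sup>2)"
    by (intro integrable_norm_add_sq integrable_norm_scaleR_sq \<Theta>_diff_L2 m_L2) measurable
  then show ?thesis by (simp add: Z_def algebra_simps)
qed

text \<open>The drift is known at \<open>\<Theta> n\<close>, whereas the momentum-free recursion is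
  that of \<open>Z n\<close>. The two differ by \<open>\<beta> n *\<^sub>R m n\<close>, so passing
  between them costs only terms that vanish with \<beta>.\<close>

lemma \<Theta>_L2_tendsto:
  assumes s0: "s \<longlonglongrightarrow> 0" and div: "\<not> summable s" and c: "c > 0"
    and K: "\<And>n. expectation (\<lambda>\<omega>. (norm (H n \<omega>))\<^sup>2) \<le> K"
    and drift: "\<And>n. expectation (\<lambda>\<omega>. (\<Theta> n \<omega> - \<theta>) \<bullet> H n \<omega>)
      \<le> - c * expectation (\<lambda>\<omega>. (norm (\<Theta> n \<omega> - \<theta>))\<^sup>2)"
  shows "(\<lambda>n. expectation (\<lambda>\<omega>. (norm (\<Theta> n \<omega> - \<theta>))\<^sup>2)) \<longlonglongrightarrow> 0"
proof -
  define L where "L = max K (expectation (\<lambda>\<omega>. (norm (m 0 \<omega>))\<^sup>2))"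
  have L: "expectation (\<lambda>\<omega>. (norm (m n \<omega>))\<^sup>2) \<le> L" for n
    unfolding L_def by (rule m_moment_le[OF K])
  define \<eta> where "\<eta> n = (1 - \<alpha>) * w n" for n
  define \<beta> where "\<beta> n = \<alpha> * w n" for n
  define a where "a n = expectation (\<lambda>\<omega>. (norm (Z n \<omega> - \<theta>))\<^sup>2)" for n
  \<comment> \<open>The summands come, in order, from replacing \<open>\<Theta> n\<close> by
    \<open>Z n\<close> in the drift, from the inner product of momentum and gradient, and from the
    square of the gradient step.\<close>
  define \<epsilon> where "\<epsilon> n = 2 * c * (\<beta> n)\<^sup>2 * L + \<beta> n * (L + K) + \<eta> n * K" for n
  have w_nonneg: "w n \<ge> 0" for n using w_props(2)[of n] s_nonneg[of n] by simp
  then have \<eta>_nonneg: "\<eta> n \<ge> 0" and \<beta>_nonneg: "\<beta> n \<ge> 0" for n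
    using \<alpha> by (auto simp: \<eta>_def \<beta>_def)
  have w0: "w \<longlonglongrightarrow> 0"
  proof (rule tendsto_sandwich[OF _ _ tendsto_const])
    show "(\<lambda>n. s n / (1 - \<alpha>)) \<longlonglongrightarrow> 0" using tendsto_divide_zero[OF s0] .
  qed (use w_nonneg w_props(3) in auto)
  then have \<eta>0: "\<eta> \<longlonglongrightarrow> 0" and \<beta>0: "\<beta> \<longlonglongrightarrow> 0"
    unfolding \<eta>_def \<beta>_def by (auto intro: tendsto_mult_right_zero)
  have \<epsilon>0: "\<epsilon> \<longlonglongrightarrow> 0"
    unfolding \<epsilon>_def by (rule tendsto_eq_intros \<eta>0 \<beta>0 refl | simp)+
  have \<eta>_div: "\<not> summable \<eta>"
  proof
    assume "summable \<eta>"
    then have "summable (\<lambda>n. \<eta> n / (1 - \<alpha>))" by (rule summable_divide)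
    then have "summable w" using \<alpha> by (simp add: \<eta>_def)
    then have "summable s"
      by (rule summable_comparison_test'[where N = 0]) (use w_props(2) s_nonneg in simp)
    with div show False ..
  qed
  have rec: "a (Suc n) \<le> (1 - c * \<eta> n) * a n + \<eta> n * \<epsilon> n" for n
  proof -
    define X where "X = expectation (\<lambda>\<omega>. (norm (\<Theta> n \<omega> - \<theta>))\<^sup>2)"
    define h where "h = expectation (\<lambda>\<omega>. (norm (H n \<omega>))\<^sup>2)"
    define \<mu> where "\<mu> = expectation (\<lambda>\<omega>. (norm (m n \<omega>))\<^sup>2)"
    have int1: "integrable M (\<lambda>\<omega>. (\<Theta> n \<omega> - \<theta>) \<bullet> H n \<omega>)"
      by (rule integrable_inner_sq) (use \<Theta>_diff_L2 H_L2 in \<open>auto\<close>)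
    have int2: "integrable M (\<lambda>\<omega>. m n \<omega> \<bullet> H n \<omega>)"
      by (rule integrable_inner_sq) (use m_L2 H_L2 in \<open>auto\<close>)
    have "(norm (Z (Suc n) \<omega> - \<theta>))\<^sup>2 = (norm (Z n \<omega> - \<theta>))\<^sup>2
        + 2 * \<eta> n * ((\<Theta> n \<omega> - \<theta>) \<bullet> H n \<omega>) + 2 * \<eta> n * \<beta> n * (m n \<omega> \<bullet> H n \<omega>)
        + (\<eta> n)\<^sup>2 * (norm (H n \<omega>))\<^sup>2" if "\<omega> \<in> space M" for \<omega>
    proof -
      have "Z (Suc n) \<omega> - \<theta> = (Z n \<omega> - \<theta>) + \<eta> n *\<^sub>R H n \<omega>"
        using Z_Suc[OF that, of n] by (simp add: \<eta>_def)
      then have "(norm (Z (Suc n) \<omega> - \<theta>))\<^sup>2 = (norm (Z n \<omega> - \<theta>))\<^sup>2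
          + 2 * \<eta> n * ((Z n \<omega> - \<theta>) \<bullet> H n \<omega>) + (\<eta> n)\<^sup>2 * (norm (H n \<omega>))\<^sup>2"
        unfolding power2_norm_eq_inner
        by (simp add: inner_add_left inner_add_right inner_commute algebra_simps power2_eq_square)
      \<comment> \<open>Splitting off the shift leaves an inner product at
        \<open>\<Theta> n\<close>, to which the drift bound applies.\<close>
      moreover have "(Z n \<omega> - \<theta>) \<bullet> H n \<omega> = (\<Theta> n \<omega> - \<theta>) \<bullet> H n \<omega> + \<beta> n * (m n \<omega> \<bullet> H n \<omega>)"
        by (simp add: Z_def \<beta>_def inner_diff_left inner_add_left)
      ultimately show ?thesis by (simp add: algebra_simps)
    qed
    then have "a (Suc n) = expectation (\<lambda>\<omega>. (norm (Z n \<omega> - \<theta>))\<^sup>2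
        + 2 * \<eta> n * ((\<Theta> n \<omega> - \<theta>) \<bullet> H n \<omega>) + 2 * \<eta> n * \<beta> n * (m n \<omega> \<bullet> H n \<omega>)
        + (\<eta> n)\<^sup>2 * (norm (H n \<omega>))\<^sup>2)"
      unfolding a_def by (intro Bochner_Integration.integral_cong) auto
    also have "\<dots> = a n + 2 * \<eta> n * expectation (\<lambda>\<omega>. (\<Theta> n \<omega> - \<theta>) \<bullet> H n \<omega>)
        + 2 * \<eta> n * \<beta> n * expectation (\<lambda>\<omega>. m n \<omega> \<bullet> H n \<omega>) + (\<eta> n)\<^sup>2 * h"
      using Z_diff_L2[of n] int1 int2 H_L2[of n] by (simp add: a_def h_def)
    finally have eq: "a (Suc n) = \<dots>" .
    have d: "\<eta> n * expectation (\<lambda>\<omega>. (\<Theta> n \<omega> - \<theta>) \<bullet> H n \<omega>) \<le> \<eta> n * (- c * X)"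
      using drift[of n] \<eta>_nonneg[of n] unfolding X_def by (intro mult_left_mono)
    have "expectation (\<lambda>\<omega>. 2 * (m n \<omega> \<bullet> H n \<omega>))
        \<le> expectation (\<lambda>\<omega>. (norm (m n \<omega>))\<^sup>2 + (norm (H n \<omega>))\<^sup>2)"
      using int2 m_L2 H_L2 by (intro integral_mono two_inner_le) auto
    then have "2 * expectation (\<lambda>\<omega>. m n \<omega> \<bullet> H n \<omega>) \<le> \<mu> + h"
      using m_L2 H_L2 by (simp add: \<mu>_def h_def)
    also have "\<dots> \<le> L + K" using L[of n] K[of n] by (simp add: \<mu>_def h_def)
    finally have mh: "\<eta> n * \<beta> n * (2 * expectation (\<lambda>\<omega>. m n \<omega> \<bullet> H n \<omega>)) \<le> \<eta> n * \<beta> n * (L + K)"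
      using \<eta>_nonneg[of n] \<beta>_nonneg[of n] by (intro mult_left_mono) auto
    have hK: "(\<eta> n)\<^sup>2 * h \<le> (\<eta> n)\<^sup>2 * K" using K[of n] by (intro mult_left_mono) (auto simp: h_def)
    \<comment> \<open>This turns the decrease \<open>2 * c * \<eta> n * X\<close> into
      \<open>c * \<eta> n * a n\<close> up to an error; the factor 2 from expanding the square is
      spent here.\<close>
    have "a n \<le> expectation (\<lambda>\<omega>. 2 * (norm (\<Theta> n \<omega> - \<theta>))\<^sup>2 + 2 * (\<beta> n)\<^sup>2 * (norm (m n \<omega>))\<^sup>2)"
      unfolding a_def
    proof (rule integral_mono)
      fix \<omega>
      have eq: "Z n \<omega> - \<theta> = (\<Theta> n \<omega> - \<theta>) + \<beta> n *\<^sub>R m n \<omega>" by (simp add: Z_def \<beta>_def)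
      show "(norm (Z n \<omega> - \<theta>))\<^sup>2 \<le> 2 * (norm (\<Theta> n \<omega> - \<theta>))\<^sup>2 + 2 * (\<beta> n)\<^sup>2 * (norm (m n \<omega>))\<^sup>2"
        unfolding eq using norm_add_sq_le[of "\<Theta> n \<omega> - \<theta>" "\<beta> n *\<^sub>R m n \<omega>"]
        by (simp add: power_mult_distrib mult.assoc)
    qed (use Z_diff_L2 \<Theta>_diff_L2 m_L2 in auto)
    also have "\<dots> = 2 * X + 2 * (\<beta> n)\<^sup>2 * \<mu>" using \<Theta>_diff_L2 m_L2 by (simp add: X_def \<mu>_def)
    also have "\<dots> \<le> 2 * X + 2 * (\<beta> n)\<^sup>2 * L"
      using mult_left_mono[OF L[of n], of "2 * (\<beta> n)\<^sup>2"] by (simp add: \<mu>_def)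
    finally have "c * \<eta> n * a n \<le> c * \<eta> n * (2 * X + 2 * (\<beta> n)\<^sup>2 * L)"
      using c \<eta>_nonneg[of n] by (intro mult_left_mono) auto
    with eq d mh hK show ?thesis
      by (simp add: \<epsilon>_def algebra_simps power2_eq_square)
  qed
  have a0: "a \<longlonglongrightarrow> 0"
    by (rule contraction_recursion_tendsto_zero[OF _ \<eta>_nonneg c \<eta>0 \<eta>_div \<epsilon>0 rec])
       (simp add: a_def)
  \<comment> \<open>The same comparison in the opposite direction returns from \<open>Z n\<close> to
    \<open>\<Theta> n\<close>.\<close>
  have upper: "expectation (\<lambda>\<omega>. (norm (\<Theta> n \<omega> - \<theta>))\<^sup>2) \<le> 2 * a n + 2 * (\<beta> n)\<^sup>2 * L" for n
  proof -
    have "expectation (\<lambda>\<omega>. (norm (\<Theta> n \<omega> - \<theta>))\<^sup>2)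
        \<le> expectation (\<lambda>\<omega>. 2 * (norm (Z n \<omega> - \<theta>))\<^sup>2 + 2 * (\<beta> n)\<^sup>2 * (norm (m n \<omega>))\<^sup>2)"
    proof (rule integral_mono)
      fix \<omega>
      have eq: "\<Theta> n \<omega> - \<theta> = (Z n \<omega> - \<theta>) + (- \<beta> n) *\<^sub>R m n \<omega>" by (simp add: Z_def \<beta>_def)
      show "(norm (\<Theta> n \<omega> - \<theta>))\<^sup>2 \<le> 2 * (norm (Z n \<omega> - \<theta>))\<^sup>2 + 2 * (\<beta> n)\<^sup>2 * (norm (m n \<omega>))\<^sup>2"
        unfolding eq using norm_add_sq_le[of "Z n \<omega> - \<theta>" "(- \<beta> n) *\<^sub>R m n \<omega>"]
        by (simp add: power_mult_distrib mult.assoc)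
    qed (use Z_diff_L2 \<Theta>_diff_L2 m_L2 in auto)
    also have "\<dots> = 2 * a n + 2 * (\<beta> n)\<^sup>2 * expectation (\<lambda>\<omega>. (norm (m n \<omega>))\<^sup>2)"
      using Z_diff_L2 m_L2 by (simp add: a_def)
    also have "\<dots> \<le> 2 * a n + 2 * (\<beta> n)\<^sup>2 * L"
      using mult_left_mono[OF L[of n], of "2 * (\<beta> n)\<^sup>2"] by simp
    finally show ?thesis .
  qed
  show ?thesis
  proof (rule tendsto_sandwich[OF _ _ tendsto_const])
    show "(\<lambda>n. 2 * a n + 2 * (\<beta> n)\<^sup>2 * L) \<longlonglongrightarrow> 0"
      by (rule tendsto_eq_intros a0 \<beta>0 refl | simp)+
  qed (use upper in \<open>auto intro!: always_eventually\<close>)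
qed

end

section \<open>Generated sigma-algebras and independence\<close>

lemma space_generated_algebra [simp]: "space (generated_algebra M X I) = space M"
  by (simp add: generated_algebra_def space_measure_of_conv)

lemma sets_generated_algebra:
  "sets (generated_algebra M X I) =
     sigma_sets (space M) (\<Union>i\<in>I. {X i -` A \<inter> space M | A. A \<in> sets borel})"
  unfolding generated_algebra_def by (rule sets_measure_of) auto

lemma measurable_generated_algebra:
  "i \<in> I \<Longrightarrow> X i \<in> borel_measurable (generated_algebra M X I)"
  by (rule measurableI) (auto simp: sets_generated_algebra intro!: sigma_sets.Basic)

lemma sets_generated_algebra_mono:
  "I \<subseteq> I' \<Longrightarrow> sets (generated_algebra M X I) \<subseteq> sets (generated_algebra M X I')"
  unfolding sets_generated_algebra by (intro sigma_sets_mono') blast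

lemma sets_vimage_algebra_subset:
  assumes "X \<in> borel_measurable F" "space F = space M"
  shows "sets (vimage_algebra (space M) X borel) \<subseteq> sets F"
  unfolding sets_vimage_algebra assms(2)[symmetric]
  using measurable_sets[OF assms(1)] by (intro sets.sigma_sets_subset) auto

text \<open>Stated for laws, since \<open>indep_var\<close> forces both variables to have the same type.\<close>

lemma (in prob_space) indep_of_algebra_joint_law:
  assumes [measurable]: "U \<in> borel_measurable M" "X \<in> borel_measurable M"
    and X: "X \<in> borel_measurable F" "space F = space M"
    and ind: "indep_of_algebra M U F"
  shows "distr M borel X \<Otimes>\<^sub>M distr M borel U = distr M (borel \<Otimes>\<^sub>M borel) (\<lambda>\<omega>. (X \<omega>, U \<omega>))"
proof (rule pair_measure_eqI)
  fix A B assume "A \<in> sets (distr M borel X)" "B \<in> sets (distr M borel U)"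
  then have [measurable]: "A \<in> sets borel" "B \<in> sets borel" by auto
  have "X -` A \<inter> space M \<in> sets F"
    using measurable_sets[OF X(1), of A] X(2) by simp
  moreover have "U -` B \<inter> space M \<in> sets (vimage_algebra (space M) U borel)"
    by (rule in_vimage_algebra) simp
  ultimately have "prob ((U -` B \<inter> space M) \<inter> (X -` A \<inter> space M))
      = prob (U -` B \<inter> space M) * prob (X -` A \<inter> space M)"
    using ind indep_setD unfolding indep_of_algebra_def by blast
  moreover have "(\<lambda>\<omega>. (X \<omega>, U \<omega>)) -` (A \<times> B) \<inter> space M
      = (U -` B \<inter> space M) \<inter> (X -` A \<inter> space M)" by auto
  ultimately show "emeasure (distr M borel X) A * emeasure (distr M borel U) B
      = emeasure (distr M (borel \<Otimes>\<^sub>M borel) (\<lambda>\<omega>. (X \<omega>, U \<omega>))) (A \<times> B)"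
    by (simp add: emeasure_distr emeasure_eq_measure ennreal_mult[symmetric] mult.commute)
qed (auto intro!: prob_space_imp_sigma_finite prob_space_distr cong: sets_pair_measure_cong)

text \<open>The preimages under each single variable form an intersection-stable generator, so
  independence of the family lifts to the sigma-algebras of disjoint blocks of indices, here two
  blocks indexed by \<open>bool\<close>.\<close>

lemma (in prob_space) indep_set_generated_algebra:
  assumes "indep_vars (\<lambda>_. borel) X I" "I1 \<subseteq> I" "I2 \<subseteq> I" "I1 \<inter> I2 = {}"
  shows "indep_set (sets (generated_algebra M X I1)) (sets (generated_algebra M X I2))"
proof -
  let ?E = "\<lambda>i. {X i -` A \<inter> space M | A. A \<in> sets borel}"
  let ?I = "case_bool I1 I2"
  have "indep_sets (\<lambda>b. sigma_sets (space M) (\<Union>i\<in>?I b. ?E i)) UNIV"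
  proof (rule indep_sets_collect_sigma)
    have "(\<Union>b. ?I b) = I1 \<union> I2" by (auto simp: UNIV_bool)
    then show "indep_sets ?E (\<Union>b. ?I b)"
      using assms indep_sets_mono_index[of "I1 \<union> I2" I ?E] by (auto simp: indep_vars_def2)
    show "Int_stable (?E i)" for i
    proof (rule Int_stableI)
      fix a b assume "a \<in> ?E i" "b \<in> ?E i"
      then obtain A B where "A \<in> sets borel" "B \<in> sets borel"
        "a = X i -` A \<inter> space M" "b = X i -` B \<inter> space M" by blast
      then show "a \<inter> b \<in> ?E i" by (intro CollectI exI[of _ "A \<inter> B"]) auto
    qed
    show "disjoint_family_on ?I UNIV"
      using assms(4) by (auto simp: disjoint_family_on_def split: bool.split)
  qed
  moreover have "(\<lambda>b. sigma_sets (space M) (\<Union>i\<in>?I b. ?E i))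
      = case_bool (sets (generated_algebra M X I1)) (sets (generated_algebra M X I2))"
    by (rule ext) (simp add: sets_generated_algebra split: bool.split)
  ultimately show ?thesis by (simp add: indep_set_def)
qed

text \<open>\<open>indep_of_algebra\<close> lists the variable first, while the construction for the
  iterates yields the large sigma-algebra first.\<close>

lemma (in prob_space) indep_set_swap_mono:
  assumes AB: "indep_set A B" and sub: "B' \<subseteq> B" "A' \<subseteq> A"
  shows "indep_set B' A'"
proof (rule indep_setI)
  show "B' \<subseteq> events" "A' \<subseteq> events"
    using indep_setD_ev1[OF AB] indep_setD_ev2[OF AB] sub by auto
  fix b a assume "b \<in> B'" "a \<in> A'"
  then have "prob (a \<inter> b) = prob a * prob b" using sub by (intro indep_setD[OF AB]) auto
  then show "prob (b \<inter> a) = prob b * prob a" by (simp add: Int_commute mult.commute)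
qed

text \<open>Since \<open>b \<inter> c\<close> lies in \<open>D\<close>, the probability of
  \<open>a \<inter> b \<inter> c\<close> factors completely. The sets \<open>a \<inter> b\<close>
  are intersection-stable, so independence extends to the generated sigma-algebras. In the
  application \<open>A\<close> belongs to the initial value, \<open>B\<close> to the samples from
  time 1 on, \<open>C\<close> to \<open>U 0 1\<close> and \<open>D\<close> to all samples.\<close>

lemma (in prob_space) indep_set_sigma_Int:
  assumes AD: "indep_set A D" and BC: "indep_set B C"
    and sub: "B \<subseteq> D" "C \<subseteq> D" and Int: "\<And>b c. b \<in> B \<Longrightarrow> c \<in> C \<Longrightarrow> b \<inter> c \<in> D"
    and st: "Int_stable A" "Int_stable B" "Int_stable C"
  shows "indep_set (sigma_sets (space M) {a \<inter> b |a b. a \<in> A \<and> b \<in> B}) (sigma_sets (space M) C)"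
proof (rule indep_set_sigma_sets)
  note ev = indep_setD_ev1[OF AD] indep_setD_ev1[OF BC] indep_setD_ev2[OF BC]
  show "indep_set {a \<inter> b |a b. a \<in> A \<and> b \<in> B} C"
  proof (rule indep_setI)
    show "{a \<inter> b |a b. a \<in> A \<and> b \<in> B} \<subseteq> events" "C \<subseteq> events" using ev by auto
    fix x c assume "x \<in> {a \<inter> b |a b. a \<in> A \<and> b \<in> B}" and c: "c \<in> C"
    then obtain a b where x: "x = a \<inter> b" "a \<in> A" "b \<in> B" by blast
    have "prob (x \<inter> c) = prob (a \<inter> (b \<inter> c))" using x by (simp add: Int_assoc)
    also have "\<dots> = prob a * prob (b \<inter> c)" using x c by (intro indep_setD[OF AD] Int)
    also have "\<dots> = (prob a * prob b) * prob c" using indep_setD[OF BC] x c by simp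
    also have "prob a * prob b = prob x" using indep_setD[OF AD x(2), of b] x sub by auto
    finally show "prob (x \<inter> c) = prob x * prob c" .
  qed
  show "Int_stable {a \<inter> b |a b. a \<in> A \<and> b \<in> B}"
  proof (rule Int_stableI)
    fix x y assume "x \<in> {a \<inter> b |a b. a \<in> A \<and> b \<in> B}" "y \<in> {a \<inter> b |a b. a \<in> A \<and> b \<in> B}"
    then obtain a b a' b' where "x = a \<inter> b" "a \<in> A" "b \<in> B" "y = a' \<inter> b'" "a' \<in> A" "b' \<in> B" by blast
    then have "x \<inter> y = (a \<inter> a') \<inter> (b \<inter> b')" "a \<inter> a' \<in> A" "b \<inter> b' \<in> B"
      using st by (auto simp: Int_stable_def)
    then show "x \<inter> y \<in> {a \<inter> b |a b. a \<in> A \<and> b \<in> B}" by blast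
  qed
qed (rule st)

section \<open>Integration against product laws and transfer between equal laws\<close>

text \<open>By Fubini the left side is an iterated integral whose inner part is bounded by
  \<open>h x\<close> for each frozen \<open>x\<close>. This takes the place of conditioning on
  \<open>X\<close>.\<close>

lemma (in prob_space) expectation_product_law_le:
  fixes f :: "'b \<times> 'c \<Rightarrow> real"
  assumes D: "distr M N X \<Otimes>\<^sub>M distr M L Y = distr M (N \<Otimes>\<^sub>M L) (\<lambda>\<omega>. (X \<omega>, Y \<omega>))"
    and [measurable]: "X \<in> measurable M N" "Y \<in> measurable M L"
    and f [measurable]: "f \<in> borel_measurable (N \<Otimes>\<^sub>M L)" and h [measurable]: "h \<in> borel_measurable N"
    and fi: "integrable M (\<lambda>\<omega>. f (X \<omega>, Y \<omega>))" and hi: "integrable M (\<lambda>\<omega>. h (X \<omega>))"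
    and le: "\<And>x. x \<in> space N \<Longrightarrow> expectation (\<lambda>\<omega>. f (x, Y \<omega>)) \<le> h x"
  shows "expectation (\<lambda>\<omega>. f (X \<omega>, Y \<omega>)) \<le> expectation (\<lambda>\<omega>. h (X \<omega>))"
proof -
  interpret PX: prob_space "distr M N X" by (rule prob_space_distr) simp
  interpret PY: prob_space "distr M L Y" by (rule prob_space_distr) simp
  interpret P: pair_prob_space "distr M N X" "distr M L Y" ..
  have fi': "integrable (distr M N X \<Otimes>\<^sub>M distr M L Y) f"
    unfolding D by (subst integrable_distr_eq) (use fi in auto)
  have "expectation (\<lambda>\<omega>. f (X \<omega>, Y \<omega>)) = integral\<^sup>L (distr M N X \<Otimes>\<^sub>M distr M L Y) f"
    unfolding D by (subst integral_distr) auto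
  also have "\<dots> = (\<integral>x. (\<integral>y. f (x, y) \<partial>distr M L Y) \<partial>distr M N X)"
    by (rule P.integral_fst'[OF fi', symmetric])
  also have "\<dots> \<le> (\<integral>x. h x \<partial>distr M N X)"
  proof (rule integral_mono)
    show "integrable (distr M N X) (\<lambda>x. \<integral>y. f (x, y) \<partial>distr M L Y)"
      by (rule P.integrable_fst'[OF fi'])
    show "integrable (distr M N X) h" by (subst integrable_distr_eq) (use hi in auto)
    fix x assume "x \<in> space (distr M N X)"
    then have x [simp]: "x \<in> space N" by simp
    have "(\<integral>y. f (x, y) \<partial>distr M L Y) = expectation (\<lambda>\<omega>. f (x, Y \<omega>))"
      by (subst integral_distr) auto
    then show "(\<integral>y. f (x, y) \<partial>distr M L Y) \<le> h x" using le[of x] by simp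
  qed
  also have "\<dots> = expectation (\<lambda>\<omega>. h (X \<omega>))" by (subst integral_distr) auto
  finally show ?thesis .
qed

text \<open>Both sides are statements about \<open>f\<close> under the common law. This exchanges
  one sample for another inside a moment.\<close>

lemma
  fixes f :: "'b \<Rightarrow> 'c::{banach, second_countable_topology}"
  assumes "distr M N Y = distr M N Y'" "Y \<in> measurable M N" "Y' \<in> measurable M N"
    "f \<in> borel_measurable N"
  shows integrable_cong_distr: "integrable M (\<lambda>\<omega>. f (Y \<omega>)) \<longleftrightarrow> integrable M (\<lambda>\<omega>. f (Y' \<omega>))"
    and integral_cong_distr: "(\<integral>\<omega>. f (Y \<omega>) \<partial>M) = (\<integral>\<omega>. f (Y' \<omega>) \<partial>M)"
  using assms by (metis integrable_distr_eq) (use assms in \<open>metis integral_distr\<close>)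

section \<open>From extended real step size conditions to real ones\<close>

lemma tendsto_zero_of_limsup_ereal:
  fixes f :: "nat \<Rightarrow> real"
  assumes "\<And>n. f n \<ge> 0" "limsup (\<lambda>n. ereal (f n)) = 0"
  shows "f \<longlonglongrightarrow> 0"
proof -
  have "0 \<le> liminf (\<lambda>n. ereal (f n))" using assms(1) by (intro Liminf_bounded) auto
  moreover have "liminf (\<lambda>n. ereal (f n)) \<le> limsup (\<lambda>n. ereal (f n))" by (intro Liminf_le_Limsup) simp
  ultimately have "(\<lambda>n. ereal (f n)) \<longlonglongrightarrow> 0" using assms(2) by (intro Liminf_eq_Limsup) auto
  then show ?thesis by (simp add: zero_ereal_def)
qed

lemma not_summable_of_suminf_ereal:
  assumes "(\<Sum>n. ereal (f n)) = \<infinity>"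
  shows "\<not> summable f"
proof
  assume "summable f"
  then have "(\<lambda>n. ereal (f n)) sums ereal (suminf f)" by (simp add: sums_ereal summable_sums)
  then show False using assms by (simp add: sums_iff)
qed

text \<open>The conclusion uses the nonnegative integral, for which an infinite second moment would
  count as infinity, whereas the Bochner integral would return 0. For the same reason the finite
  supremum of the gradient moments is encoded as integrability together with boundedness.\<close>

theorem corollary3p6:
  fixes M :: "'a measure"
    and J :: nat
    and U :: "nat \<Rightarrow> nat \<Rightarrow> 'a \<Rightarrow> real ^ 'e"
    and G :: "(real ^ 'd) \<times> (real ^ 'e) \<Rightarrow> real ^ 'd"
    and \<alpha> c :: real
    and \<nu> \<theta>' :: "real ^ 'd"
    and \<gamma> :: "nat \<Rightarrow> real"
    and \<Theta> m :: "nat \<Rightarrow> 'a \<Rightarrow> real ^ 'd"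
  assumes "prob_space M"
    and "J \<ge> 1"
    and "iid M (\<lambda>(n, j). U n j) (UNIV \<times> {1..J})"
    and "G \<in> borel_measurable (borel \<Otimes>\<^sub>M borel)"
    and "\<And>\<theta>. integrable M (\<lambda>\<omega>. norm (G (\<theta>, U 0 1 \<omega>)))"
    and "0 \<le> \<alpha>" and "\<alpha> < 1"
    and "\<And>n. \<gamma> n > 0"
    and "\<And>n. \<Theta> n \<in> borel_measurable M"
    and "\<And>n. m n \<in> borel_measurable M"
    and "\<And>\<omega>. \<omega> \<in> space M \<Longrightarrow> m 0 \<omega> = \<nu>"
    and "\<And>n \<omega>. n \<ge> 1 \<Longrightarrow> \<omega> \<in> space M \<Longrightarrow> \<Theta> n \<omega> = \<Theta> (n - 1) \<omega> + \<gamma> n *\<^sub>R m n \<omega>"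
    and "\<And>n \<omega>. n \<ge> 1 \<Longrightarrow> \<omega> \<in> space M \<Longrightarrow>
           m n \<omega> = \<alpha> *\<^sub>R m (n - 1) \<omega> +
             (1 - \<alpha>) *\<^sub>R ((1 / real J) *\<^sub>R (\<Sum>j = 1..J. G (\<Theta> (n - 1) \<omega>, U n j \<omega>)))"
    and "indep_of_algebra M (\<Theta> 0)
           (generated_algebra M (\<lambda>(n, j). U n j) (UNIV \<times> {1..J}))"
    and "integrable M (\<lambda>\<omega>. (norm (\<Theta> 0 \<omega>))\<^sup>2)"
    and "\<And>n j. n \<ge> 1 \<Longrightarrow> j \<in> {1..J} \<Longrightarrow>
           indep_of_algebra M (U n j) (natural_filtration M \<Theta> (n - 1))"
    and "\<And>n. integrable M (\<lambda>\<omega>. (norm (G (\<Theta> n \<omega>, U 0 1 \<omega>)))\<^sup>2)"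
    and "bdd_above (range (\<lambda>n. sqrt (\<integral>\<omega>. (norm (G (\<Theta> n \<omega>, U 0 1 \<omega>)))\<^sup>2 \<partial>M)))"
    and "c > 0"
    and "\<And>\<theta>. (\<theta> - \<theta>') \<bullet> (\<integral>\<omega>. G (\<theta>, U 1 1 \<omega>) \<partial>M)
           \<le> - c * max ((norm (\<theta> - \<theta>'))\<^sup>2) ((norm (\<integral>\<omega>. G (\<theta>, U 1 1 \<omega>) \<partial>M))\<^sup>2)"
    and "\<And>j. j \<ge> 1 \<Longrightarrow> \<gamma> (j + 1) \<le> \<gamma> j"
    and "limsup (\<lambda>n. ereal (\<gamma> n)) = 0"
    and "(\<Sum>n. ereal (\<gamma> (Suc n))) = \<infinity>"
  shows "limsup (\<lambda>n. \<integral>\<^sup>+ \<omega>. ennreal ((norm (\<Theta> n \<omega> - \<theta>'))\<^sup>2) \<partial>M) = 0"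
proof -
  interpret prob_space M by fact
  note [measurable] = assms(4) assms(9) assms(10)
  have J: "J \<ge> 1" by fact
  have \<alpha>: "0 \<le> \<alpha>" "\<alpha> < 1" by fact+
  let ?I = "UNIV \<times> {1..J}"
  have ind: "indep_vars (\<lambda>_. borel) (\<lambda>(n, j). U n j) ?I"
    and law: "\<And>i k. i \<in> ?I \<Longrightarrow> k \<in> ?I \<Longrightarrow>
      distr M borel (case i of (n, j) \<Rightarrow> U n j) = distr M borel (case k of (n, j) \<Rightarrow> U n j)"
    using assms(3) by (auto simp: iid_def)
  have U_meas: "U n j \<in> borel_measurable M" if "j \<in> {1..J}" for n j
    using ind that by (auto simp: indep_vars_def)
  have U_law: "distr M borel (U n j) = distr M borel (U n' j')"
    if "j \<in> {1..J}" "j' \<in> {1..J}" for n n' j j'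
    using law[of "(n, j)" "(n', j')"] that by simp
  have 1: "1 \<in> {1..J}" using J by simp
  note U01 [measurable] = U_meas[OF 1, of 0]

  \<comment> \<open>Rewriting the scheme as a shifted momentum recursion\<close>
  define H where "H n \<omega> = (1 / real J) *\<^sub>R (\<Sum>j = 1..J. G (\<Theta> n \<omega>, U (Suc n) j \<omega>))" for n \<omega>
  define s where "s n = \<gamma> (Suc n)" for n
  \<comment> \<open>The sigma-algebra is left open because this is applied both to \<open>M\<close>
    and to the smaller \<open>F\<close> constructed below.\<close>
  have H_meas [measurable]: "H n \<in> borel_measurable F"
    if [measurable]: "\<Theta> n \<in> borel_measurable F"
      "\<And>j. j \<in> {1..J} \<Longrightarrow> U (Suc n) j \<in> borel_measurable F" for n F
    unfolding H_def by measurable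
  have m_Suc: "m (Suc n) \<omega> = \<alpha> *\<^sub>R m n \<omega> + (1 - \<alpha>) *\<^sub>R H n \<omega>" if "\<omega> \<in> space M" for n \<omega>
    using assms(13)[of "Suc n" \<omega>] that by (simp add: H_def)
  have \<Theta>_Suc: "\<Theta> (Suc n) \<omega> = \<Theta> n \<omega> + s n *\<^sub>R m (Suc n) \<omega>" if "\<omega> \<in> space M" for n \<omega>
    using assms(12)[of "Suc n" \<omega>] that by (simp add: s_def)

  \<comment> \<open>Independence of \<open>U 0 1\<close> from the iterates\<close>
  have ind_0: "indep_of_algebra M (U 0 1) (natural_filtration M \<Theta> n)" for n
  proof -
    let ?U = "\<lambda>(n, j). U n j"
    define A where "A = sets (vimage_algebra (space M) (\<Theta> 0) borel)"
    \<comment> \<open>Time 0 is left out: the updates use only \<open>U (Suc n) j\<close>, so this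
      block is disjoint from the index \<open>(0, 1)\<close> and still drives all iterates.\<close>
    define B where "B = sets (generated_algebra M ?U ({1..} \<times> {1..J}))"
    define C where "C = sets (generated_algebra M ?U {(0, 1)})"
    define D where "D = sets (generated_algebra M ?U ?I)"
    \<comment> \<open>These intersections form a generator of the join \<open>F\<close> of
      \<open>A\<close> and \<open>B\<close>. It contains \<open>A\<close> and \<open>B\<close>
      themselves, because \<open>space M\<close> belongs to both.\<close>
    define E where "E = {a \<inter> b |a b. a \<in> A \<and> b \<in> B}"
    define F where "F = sigma (space M) E"
    have sub: "B \<subseteq> D" "C \<subseteq> D"
      unfolding B_def C_def D_def using 1 by (auto intro!: sets_generated_algebra_mono)
    have st: "Int_stable (sets N)" for N :: "'a measure" by (auto simp: Int_stable_def)
    have BC: "indep_set B C"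
      unfolding B_def C_def using 1 by (intro indep_set_generated_algebra[OF ind]) auto
    have AD: "indep_set A D" using assms(14) by (simp add: indep_of_algebra_def A_def D_def)
    have FC: "indep_set (sigma_sets (space M) E) (sigma_sets (space M) C)"
      unfolding E_def
    proof (rule indep_set_sigma_Int[OF AD BC sub])
      show "b \<inter> c \<in> D" if "b \<in> B" "c \<in> C" for b c
        using that sub unfolding D_def by blast
    qed (simp_all add: A_def B_def C_def st)
    have spA: "space M \<in> A" and spB: "space M \<in> B"
      using sets.top[of "vimage_algebra (space M) (\<Theta> 0) borel"]
        sets.top[of "generated_algebra M ?U ({1..} \<times> {1..J})"]
      by (simp_all add: A_def B_def del: sets.top)
    have AP: "a \<subseteq> space M" if "a \<in> A" for a
      using that sets.sets_into_space[of a "vimage_algebra (space M) (\<Theta> 0) borel"] by (simp add: A_def)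
    have BP: "b \<subseteq> space M" if "b \<in> B" for b
      using that sets.sets_into_space[of b "generated_algebra M ?U ({1..} \<times> {1..J})"] by (simp add: B_def)
    have sets_F: "sets F = sigma_sets (space M) E" and space_F [simp]: "space F = space M"
      unfolding F_def using AP by (auto simp: E_def intro!: sets_measure_of space_measure_of)
    have AF: "A \<subseteq> sets F" and BF: "B \<subseteq> sets F"
    proof -
      have "a \<in> E" if "a \<in> A" for a
        unfolding E_def using that spB AP[OF that] by (intro CollectI exI[of _ a] exI[of _ "space M"]) auto
      moreover have "b \<in> E" if "b \<in> B" for b
        unfolding E_def using that spA BP[OF that] by (intro CollectI exI[of _ "space M"] exI[of _ b]) auto
      ultimately show "A \<subseteq> sets F" "B \<subseteq> sets F" by (auto simp: sets_F)
    qed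
    have U_F: "U (Suc n) j \<in> borel_measurable F" if "j \<in> {1..J}" for n j
    proof -
      have "?U (Suc n, j) \<in> borel_measurable (generated_algebra M ?U ({1..} \<times> {1..J}))"
        using that by (intro measurable_generated_algebra) auto
      then show ?thesis
        using measurable_mono[of borel borel "generated_algebra M ?U ({1..} \<times> {1..J})" F] BF
        by (auto simp: B_def)
    qed
    have "\<Theta> 0 \<in> borel_measurable (vimage_algebra (space M) (\<Theta> 0) borel)"
      by (rule measurable_vimage_algebra1) simp
    then have \<Theta>0_F: "\<Theta> 0 \<in> borel_measurable F"
      using measurable_mono[of borel borel "vimage_algebra (space M) (\<Theta> 0) borel" F] AF
      by (auto simp: A_def)
    \<comment> \<open>Both processes go through one induction, since each update of
      \<open>\<Theta>\<close> uses the new momentum and that one uses the old pair. The recursions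
      hold on \<open>space M\<close> only, hence \<open>measurable_cong\<close>.\<close>
    have \<Theta>m_F: "\<Theta> n \<in> borel_measurable F \<and> m n \<in> borel_measurable F" for n
    proof (induction n)
      case 0
      have "m 0 \<in> borel_measurable F \<longleftrightarrow> (\<lambda>_. \<nu>) \<in> borel_measurable F"
        by (rule measurable_cong) (simp add: assms(11))
      with \<Theta>0_F show ?case by simp
    next
      case (Suc n)
      then have [measurable]: "\<Theta> n \<in> borel_measurable F" "m n \<in> borel_measurable F" by auto
      have [measurable]: "H n \<in> borel_measurable F" by (rule H_meas) (auto intro: U_F)
      have "m (Suc n) \<in> borel_measurable F
          \<longleftrightarrow> (\<lambda>\<omega>. \<alpha> *\<^sub>R m n \<omega> + (1 - \<alpha>) *\<^sub>R H n \<omega>) \<in> borel_measurable F"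
        by (rule measurable_cong) (simp add: m_Suc)
      then have [measurable]: "m (Suc n) \<in> borel_measurable F" by simp
      have "\<Theta> (Suc n) \<in> borel_measurable F
          \<longleftrightarrow> (\<lambda>\<omega>. \<Theta> n \<omega> + s n *\<^sub>R m (Suc n) \<omega>) \<in> borel_measurable F"
        by (rule measurable_cong) (simp add: \<Theta>_Suc)
      then show ?case by simp
    qed
    have "sets (natural_filtration M \<Theta> n) \<subseteq> sets F"
      unfolding natural_filtration_def sets_generated_algebra space_F[symmetric]
      using measurable_sets[OF conjunct1[OF \<Theta>m_F]] by (intro sets.sigma_sets_subset) auto
    moreover have "sets (vimage_algebra (space M) (U 0 1) borel) \<subseteq> sigma_sets (space M) C"
    proof -
      have "?U (0, 1) \<in> borel_measurable (generated_algebra M ?U {(0, 1)})"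
        by (rule measurable_generated_algebra) simp
      then have "sets (vimage_algebra (space M) (U 0 1) borel) \<subseteq> C"
        unfolding C_def by (intro sets_vimage_algebra_subset) auto
      then show ?thesis by auto
    qed
    ultimately show ?thesis
      using indep_set_swap_mono[OF FC] unfolding indep_of_algebra_def sets_F by blast
  qed

  \<comment> \<open>Joint laws and moment bounds for the gradients\<close>
  have \<Theta>_filt: "\<Theta> n \<in> borel_measurable (natural_filtration M \<Theta> n)" for n
    unfolding natural_filtration_def by (rule measurable_generated_algebra) simp
  have space_filt: "space (natural_filtration M \<Theta> n) = space M" for n
    by (simp add: natural_filtration_def)
  have joint: "distr M borel (\<Theta> n) \<Otimes>\<^sub>M distr M borel (U k j)
      = distr M (borel \<Otimes>\<^sub>M borel) (\<lambda>\<omega>. (\<Theta> n \<omega>, U k j \<omega>))"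
    if "indep_of_algebra M (U k j) (natural_filtration M \<Theta> n)" "j \<in> {1..J}" for n k j
    by (rule indep_of_algebra_joint_law[OF U_meas[OF that(2)] assms(9) \<Theta>_filt space_filt that(1)])
  have joint_Suc: "distr M borel (\<Theta> n) \<Otimes>\<^sub>M distr M borel (U (Suc n) j)
      = distr M (borel \<Otimes>\<^sub>M borel) (\<lambda>\<omega>. (\<Theta> n \<omega>, U (Suc n) j \<omega>))" if "j \<in> {1..J}" for n j
    using joint[of "Suc n" j n] assms(16)[of "Suc n" j] that by simp
  \<comment> \<open>Both sides are the product of the law of \<open>\<Theta> n\<close> with the
    common law of the samples. The moment bound for \<open>U 0 1\<close> therefore holds for the
    samples used in the update.\<close>
  have joint_law: "distr M (borel \<Otimes>\<^sub>M borel) (\<lambda>\<omega>. (\<Theta> n \<omega>, U (Suc n) j \<omega>))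
      = distr M (borel \<Otimes>\<^sub>M borel) (\<lambda>\<omega>. (\<Theta> n \<omega>, U 0 1 \<omega>))" if "j \<in> {1..J}" for n j
    using joint_Suc[OF that, of n] joint[OF ind_0 1, of n] U_law[OF that 1, of "Suc n" 0] by simp

  obtain B where B: "\<And>n. sqrt (expectation (\<lambda>\<omega>. (norm (G (\<Theta> n \<omega>, U 0 1 \<omega>)))\<^sup>2)) \<le> B"
    using assms(18) by (auto simp: bdd_above_def)
  define K where "K = B\<^sup>2"
  have K: "expectation (\<lambda>\<omega>. (norm (G (\<Theta> n \<omega>, U 0 1 \<omega>)))\<^sup>2) \<le> K" for n
    unfolding K_def using B[of n] by (rule sqrt_le_D)
  have G_L2: "integrable M (\<lambda>\<omega>. (norm (G (\<Theta> n \<omega>, U (Suc n) j \<omega>)))\<^sup>2)"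
    and G_K: "expectation (\<lambda>\<omega>. (norm (G (\<Theta> n \<omega>, U (Suc n) j \<omega>)))\<^sup>2) \<le> K"
    if j: "j \<in> {1..J}" for n j
  proof -
    note [measurable] = U_meas[OF j]
    have *: "(\<lambda>p. (norm (G p))\<^sup>2) \<in> borel_measurable (borel \<Otimes>\<^sub>M borel)"
      "(\<lambda>\<omega>. (\<Theta> n \<omega>, U (Suc n) j \<omega>)) \<in> M \<rightarrow>\<^sub>M borel \<Otimes>\<^sub>M borel"
      "(\<lambda>\<omega>. (\<Theta> n \<omega>, U 0 1 \<omega>)) \<in> M \<rightarrow>\<^sub>M borel \<Otimes>\<^sub>M borel"
      by measurable
    show "integrable M (\<lambda>\<omega>. (norm (G (\<Theta> n \<omega>, U (Suc n) j \<omega>)))\<^sup>2)"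
      using integrable_cong_distr[OF joint_law[OF j] *(2,3,1)] assms(17)[of n] by simp
    show "expectation (\<lambda>\<omega>. (norm (G (\<Theta> n \<omega>, U (Suc n) j \<omega>)))\<^sup>2) \<le> K"
      using integral_cong_distr[OF joint_law[OF j] *(2,3,1)] K[of n] by simp
  qed
  have H_M [measurable]: "H n \<in> borel_measurable M" for n by (rule H_meas[OF assms(9) U_meas])
  have mean_L2: "integrable M (\<lambda>\<omega>. (1 / real J) * (\<Sum>j = 1..J. (norm (G (\<Theta> n \<omega>, U (Suc n) j \<omega>)))\<^sup>2))" for n
    by (intro integrable_mult_right Bochner_Integration.integrable_sum G_L2)
  have H_le: "(norm (H n \<omega>))\<^sup>2 \<le> (1 / real J) * (\<Sum>j = 1..J. (norm (G (\<Theta> n \<omega>, U (Suc n) j \<omega>)))\<^sup>2)" for n \<omega>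
    unfolding H_def by (rule norm_mean_sq_le[OF J])
  have H_L2: "integrable M (\<lambda>\<omega>. (norm (H n \<omega>))\<^sup>2)" for n
    by (rule Bochner_Integration.integrable_bound[OF mean_L2[of n]])
       (auto simp del: times_divide_eq_left intro!: order_trans[OF H_le] abs_ge_self always_eventually)
  have H_K: "expectation (\<lambda>\<omega>. (norm (H n \<omega>))\<^sup>2) \<le> K" for n
  proof -
    have "expectation (\<lambda>\<omega>. (norm (H n \<omega>))\<^sup>2)
        \<le> expectation (\<lambda>\<omega>. (1 / real J) * (\<Sum>j = 1..J. (norm (G (\<Theta> n \<omega>, U (Suc n) j \<omega>)))\<^sup>2))"
      by (intro integral_mono H_L2 mean_L2 H_le)
    also have "\<dots> = (1 / real J) * (\<Sum>j = 1..J. expectation (\<lambda>\<omega>. (norm (G (\<Theta> n \<omega>, U (Suc n) j \<omega>)))\<^sup>2))"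
      using G_L2 by (simp add: Bochner_Integration.integral_sum)
    also have "\<dots> \<le> (1 / real J) * (\<Sum>j = 1..J. K)"
      by (intro mult_left_mono sum_mono G_K) auto
    also have "\<dots> = K" using J by simp
    finally show ?thesis .
  qed

  interpret momentum_process M \<Theta> m H \<alpha> s
  proof
    \<comment> \<open>\<open>s\<close> begins with \<open>\<gamma> 1\<close>, which matches the
      range in which the step sizes are assumed nonincreasing.\<close>
    show "decseq s" using assms(21) by (auto simp: s_def decseq_Suc_iff)
    show "integrable M (\<lambda>\<omega>. (norm (m 0 \<omega>))\<^sup>2)"
      by (subst Bochner_Integration.integrable_cong[OF refl, where g = "\<lambda>_. (norm \<nu>)\<^sup>2"])
         (simp_all add: assms(11))
  qed (use assms(8,9,10,15) \<alpha> m_Suc \<Theta>_Suc H_L2 in \<open>auto simp: s_def less_imp_le\<close>)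

  \<comment> \<open>The drift condition in expectation\<close>
  have drift_j: "expectation (\<lambda>\<omega>. (\<Theta> n \<omega> - \<theta>') \<bullet> G (\<Theta> n \<omega>, U (Suc n) j \<omega>))
      \<le> expectation (\<lambda>\<omega>. - c * (norm (\<Theta> n \<omega> - \<theta>'))\<^sup>2)"
    and int_j: "integrable M (\<lambda>\<omega>. (\<Theta> n \<omega> - \<theta>') \<bullet> G (\<Theta> n \<omega>, U (Suc n) j \<omega>))"
    if j: "j \<in> {1..J}" for n j
  proof -
    note Uj [measurable] = U_meas[OF j, of "Suc n"]
    show int: "integrable M (\<lambda>\<omega>. (\<Theta> n \<omega> - \<theta>') \<bullet> G (\<Theta> n \<omega>, U (Suc n) j \<omega>))"
      by (rule integrable_inner_sq) (use \<Theta>_diff_L2 G_L2[OF j] in \<open>auto\<close>)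
    show "expectation (\<lambda>\<omega>. (\<Theta> n \<omega> - \<theta>') \<bullet> G (\<Theta> n \<omega>, U (Suc n) j \<omega>))
      \<le> expectation (\<lambda>\<omega>. - c * (norm (\<Theta> n \<omega> - \<theta>'))\<^sup>2)"
    \<comment> \<open>The coercivity assumption speaks of deterministic points, so
      \<open>\<Theta> n\<close> is frozen at \<open>x\<close> and the fresh sample is integrated out
      first.\<close>
    proof (rule expectation_product_law_le[OF joint_Suc[OF j] assms(9) Uj,
          where f = "\<lambda>p. (fst p - \<theta>') \<bullet> G p" and h = "\<lambda>x. - c * (norm (x - \<theta>'))\<^sup>2",
          unfolded fst_conv])
      fix x :: "real ^ 'd"
      have Gx: "(\<lambda>u. G (x, u)) \<in> borel_measurable borel" by measurable
      have "(\<lambda>\<omega>. G (x, U 0 1 \<omega>)) \<in> borel_measurable M" by measurable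
      \<comment> \<open>Integrability is assumed for \<open>U 0 1\<close> and coercivity for
        \<open>U 1 1\<close>; equality of laws carries both to \<open>U (Suc n) j\<close>.
        Integrability allows the inner product to be pulled out of the integral.\<close>
      from integrable_norm_iff[OF this] have "integrable M (\<lambda>\<omega>. G (x, U 0 1 \<omega>))"
        using assms(5)[of x] by blast
      then have "integrable M (\<lambda>\<omega>. G (x, U (Suc n) j \<omega>))"
        using integrable_cong_distr[OF U_law[OF 1 j, of 0 "Suc n"] U01 Uj Gx] by simp
      then have "expectation (\<lambda>\<omega>. (x - \<theta>') \<bullet> G (x, U (Suc n) j \<omega>))
          = (x - \<theta>') \<bullet> (\<integral>\<omega>. G (x, U (Suc n) j \<omega>) \<partial>M)" by simp
      also have "\<dots> = (x - \<theta>') \<bullet> (\<integral>\<omega>. G (x, U 1 1 \<omega>) \<partial>M)"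
        using integral_cong_distr[OF U_law[OF 1 j, of 1 "Suc n"] U_meas[OF 1] Uj Gx] by simp
      also have "\<dots> \<le> - c * max ((norm (x - \<theta>'))\<^sup>2) ((norm (\<integral>\<omega>. G (x, U 1 1 \<omega>) \<partial>M))\<^sup>2)"
        by (rule assms(20))
      also have "\<dots> \<le> - c * (norm (x - \<theta>'))\<^sup>2"
        using \<open>c > 0\<close> by (intro mult_left_mono_neg) auto
      finally show "expectation (\<lambda>\<omega>. (x - \<theta>') \<bullet> G (x, U (Suc n) j \<omega>)) \<le> - c * (norm (x - \<theta>'))\<^sup>2" .
    qed (use int \<Theta>_diff_L2 in auto)
  qed
  have drift: "expectation (\<lambda>\<omega>. (\<Theta> n \<omega> - \<theta>') \<bullet> H n \<omega>)
      \<le> - c * expectation (\<lambda>\<omega>. (norm (\<Theta> n \<omega> - \<theta>'))\<^sup>2)" for n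
  proof -
    have "expectation (\<lambda>\<omega>. (\<Theta> n \<omega> - \<theta>') \<bullet> H n \<omega>)
        = (1 / real J) * (\<Sum>j = 1..J. expectation (\<lambda>\<omega>. (\<Theta> n \<omega> - \<theta>') \<bullet> G (\<Theta> n \<omega>, U (Suc n) j \<omega>)))"
      unfolding H_def inner_scaleR_right inner_sum_right using int_j
      by (simp add: Bochner_Integration.integral_sum)
    also have "\<dots> \<le> (1 / real J) * (\<Sum>j = 1..J. expectation (\<lambda>\<omega>. - c * (norm (\<Theta> n \<omega> - \<theta>'))\<^sup>2))"
      by (intro mult_left_mono sum_mono drift_j) auto
    also have "\<dots> = - c * expectation (\<lambda>\<omega>. (norm (\<Theta> n \<omega> - \<theta>'))\<^sup>2)" using J by simp
    finally show ?thesis .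
  qed

  \<comment> \<open>Step size conditions and conclusion\<close>
  have "\<gamma> \<longlonglongrightarrow> 0" using assms(8,22) by (intro tendsto_zero_of_limsup_ereal) (auto simp: less_imp_le)
  then have "s \<longlonglongrightarrow> 0" unfolding s_def by (rule LIMSEQ_Suc)
  moreover have "\<not> summable s" using assms(23) unfolding s_def by (rule not_summable_of_suminf_ereal)
  ultimately have "(\<lambda>n. expectation (\<lambda>\<omega>. (norm (\<Theta> n \<omega> - \<theta>'))\<^sup>2)) \<longlonglongrightarrow> 0"
    by (rule \<Theta>_L2_tendsto[OF _ _ \<open>c > 0\<close> H_K drift])
  then have "(\<lambda>n. ennreal (expectation (\<lambda>\<omega>. (norm (\<Theta> n \<omega> - \<theta>'))\<^sup>2))) \<longlonglongrightarrow> ennreal 0"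
    by (rule tendsto_ennrealI)
  then have "(\<lambda>n. \<integral>\<^sup>+ \<omega>. ennreal ((norm (\<Theta> n \<omega> - \<theta>'))\<^sup>2) \<partial>M) \<longlonglongrightarrow> 0"
    by (subst nn_integral_eq_integral[OF \<Theta>_diff_L2]) auto
  then show ?thesis by (intro lim_imp_Limsup) auto
qed

end
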